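(* (Simpson inequality) Let $I\subset\mathbb{R}$ be an interval with interior $I^{\circ}$, and let $f:I\to\mathbb{R}$ be a twice differentiable mapping on $I^{\circ}$ such that $f,f',f''\in L[a,b]$, where $a,b\in I$ with $a<b$. Let $p,q\ge 1$ with $\frac1p+\frac1q=1$, and suppose $|f''|^q$ is convex on $[a,b]$. Then $$\left|\frac16\left[f(a)+4f\left(\tfrac{a+b}{2}\right)+f(b)\right]-\frac1{b-a}\int_a^b f(x)\,dx\right|\le (b-a)^2\left(\frac{2^{p+1}-1}{2^{2p+1}3^{p+1}(p+1)}\right)^{\frac1p}\left\{\left[\frac{1}{2^{q+2}(q+2)}|f''(b)|^q+\beta\left(\tfrac12;q+1,2\right)|f''(a)|^q\right]^{\frac1q}+\left[\beta\left(\tfrac12;q+1,2\right)|f''(b)|^q+\frac{1}{2^{q+2}(q+2)}|f''(a)|^q\right]^{\frac1q}\right\}.$$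
   Context: $L[a,b]$ denotes the integrable real-valued functions on $[a,b]$. $\beta$ is the (unnormalized) incomplete Beta function $\beta(x;u,v)=\int_0^x t^{u-1}(1-t)^{v-1}\,dt$ for $x\in[0,1]$, $u,v>0$.
   Formalization: If a or b is an endpoint of I, f is also assumed twice differentiable there in the one-sided sense (derivatives within I), so that f''(a), f''(b) are defined; otherwise f could jump at a or b and the inequality would fail. *)

theory Defs
  imports "HOL-Analysis.Analysis"
begin

(* Unnormalized incomplete Beta function, for x in [0,1] and u, v > 0.
   The convention 0 powr 0 = 0 affects the integrand only at t = 0 and t = 1. *)
definition incomplete_Beta :: "real \<Rightarrow> real \<Rightarrow> real \<Rightarrow> real" where
  "incomplete_Beta x u v = integral {0..x} (\<lambda>t. t powr (u - 1) * (1 - t) powr (v - 1))"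

end

theory Submission
  imports Defs
begin

text \<open>
  Write \<open>L = b - a\<close>. Integrating by parts twice on each half of the interval expresses the error as
  \<open>L\<^sup>2\<close> times integrals of \<open>t/2 (1/3 - t)\<close> against \<open>f''(a + L t)\<close> and \<open>f''(b - L t)\<close>, \<open>0 \<le> t \<le> 1/2\<close>.
  Hoelder's inequality for the factors \<open>1/3 - t\<close> and \<open>t f''\<close> gives the claim only with \<open>2 powr (p + 1) + 1\<close>
  in place of \<open>2 powr (p + 1) - 1\<close>, but it is wasteful: the smaller constant is reached by bounding
  \<open>|f''|\<close> by the concave function \<open>G powr (1/q)\<close>, with \<open>G\<close> the linear interpolant of \<open>|f''| powr q\<close>,
  and this in turn by its tangent at a suitable value \<open>c\<close> of \<open>G\<close>, so that only polynomials are integrated.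
  What remains is a comparison of constants, with room to spare.
\<close>

section \<open>Tangent inequalities for real powers\<close>

text \<open>Concavity of the power: weighted AM-GM for \<open>x / c\<close> and \<open>1\<close>
  with weights \<open>\<alpha>\<close> and \<open>1 - \<alpha>\<close>, rescaled by
  \<open>c powr \<alpha>\<close>.\<close>

lemma powr_tangent:
  fixes x c \<alpha> :: real
  assumes "0 \<le> x" "0 < c" "0 < \<alpha>" "\<alpha> \<le> 1"
  shows "x powr \<alpha> \<le> c powr \<alpha> * (1 - \<alpha> + \<alpha> * (x / c))"
proof (cases "x = 0")
  case True
  then show ?thesis using assms by simp
next
  case False
  then have "(x / c) powr \<alpha> * 1 powr (1 - \<alpha>) \<le> \<alpha> * (x / c) + (1 - \<alpha>) * 1"
    using assms by (intro Youngs_inequality_0) auto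
  then have "c powr \<alpha> * (x / c) powr \<alpha> \<le> c powr \<alpha> * (1 - \<alpha> + \<alpha> * (x / c))"
    by (intro mult_left_mono) auto
  then show ?thesis using assms by (simp add: powr_divide)
qed

text \<open>The tangent at \<open>1\<close> for the exponent \<open>1 / r\<close>, evaluated at
  \<open>(1 + x) powr r\<close> and solved for that power.\<close>

lemma Bernoulli_powr:
  fixes x r :: real
  assumes "-1 < x" "1 \<le> r"
  shows "1 + r * x \<le> (1 + x) powr r"
proof -
  have "((1 + x) powr r) powr (1 / r) \<le> 1 powr (1 / r) * (1 - 1 / r + 1 / r * ((1 + x) powr r / 1))"
    using assms by (intro powr_tangent) auto
  then have "1 + x \<le> 1 - 1 / r + (1 + x) powr r / r"
    using assms by (simp add: powr_powr)
  then have "r * (1 + x) \<le> r * (1 - 1 / r + (1 + x) powr r / r)"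
    using assms by (intro mult_left_mono) auto
  also have "\<dots> = r - 1 + (1 + x) powr r"
    using assms by (simp add: distrib_left right_diff_distrib)
  finally show ?thesis by (simp add: distrib_left)
qed

text \<open>For second parameter 2 the integrand is \<open>t powr q - t powr (q + 1)\<close>, so the
  integral is elementary. The form shows the factor \<open>(q + 3) / (q + 1)\<close> by which it
  exceeds the other weight of the theorem.\<close>

lemma incomplete_Beta_half:
  fixes q :: real
  assumes "0 \<le> q"
  shows "incomplete_Beta (1 / 2) (q + 1) 2 = (q + 3) / (2 powr (q + 2) * (q + 1) * (q + 2))"
proof -
  have "((\<lambda>t. t powr q - t powr (q + 1)) has_integral
      ((1 / 2) powr (q + 1) / (q + 1) - (1 / 2) powr (q + 1 + 1) / (q + 1 + 1))) {0..1/2::real}"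
    using assms by (intro has_integral_diff has_integral_powr_from_0) auto
  then have "((\<lambda>t. t powr (q + 1 - 1) * (1 - t) powr (2 - 1)) has_integral
      ((1 / 2) powr (q + 1) / (q + 1) - (1 / 2) powr (q + 1 + 1) / (q + 1 + 1))) {0..1/2::real}"
    by (rule has_integral_eq[rotated]) (auto simp: algebra_simps powr_add)
  then have "incomplete_Beta (1 / 2) (q + 1) 2 =
      (1 / 2) powr (q + 1) / (q + 1) - (1 / 2) powr (q + 1 + 1) / (q + 1 + 1)"
    unfolding incomplete_Beta_def by (rule integral_unique)
  also have "\<dots> = 1 / (2 * 2 powr q * (q + 1)) - 1 / (4 * 2 powr q * (q + 2))"
    by (simp add: powr_add powr_divide ac_simps)
  also have "\<dots> = (q + 3) / (4 * 2 powr q * (q + 1) * (q + 2))"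
    using assms by (simp add: divide_simps) algebra
  also have "\<dots> = (q + 3) / (2 powr (q + 2) * (q + 1) * (q + 2))"
    by (simp add: powr_add)
  finally show ?thesis .
qed

section \<open>Error estimate on one half of the interval\<close>

text \<open>
  The numbers \<open>77/17280\<close> and \<open>89/8640\<close> are the integrals of \<open>t \<omega> t\<close> and \<open>(1 - t) \<omega> t\<close>
  over \<open>[0, 1/2]\<close>, where \<open>\<omega>\<close> majorizes \<open>t |1/3 - t|\<close>; the integral of \<open>\<omega>\<close> itself is \<open>17/1152 \<le> 1/64\<close>.
\<close>
lemma simpson_half:
  fixes h h' h'' H :: "real \<Rightarrow> real" and A B c q S :: real
  assumes H: "\<And>t. t \<in> {0..1/2} \<Longrightarrow> (H has_real_derivative h t) (at t within {0..1/2})"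
    and h: "\<And>t. t \<in> {0..1/2} \<Longrightarrow> (h has_real_derivative h' t) (at t within {0..1/2})"
    and h': "\<And>t. t \<in> {0..1/2} \<Longrightarrow> (h' has_real_derivative h'' t) (at t within {0..1/2})"
    and h'': "\<And>t. t \<in> {0..1/2} \<Longrightarrow> \<bar>h'' t\<bar> \<le> S * (t * B + (1 - t) * A) powr (1 / q)"
    and "0 \<le> A" "0 \<le> B" and S: "0 \<le> S" and q: "1 \<le> q"
    and c: "77 / 17280 * B + 89 / 8640 * A \<le> c / 64"
  shows "\<bar>h 0 / 6 + h (1/2) / 3 - h' (1/2) / 24 - (H (1/2) - H 0)\<bar> \<le> S / 128 * c powr (1 / q)"
proof -
  define G where "G t = t * B + (1 - t) * A" for t
  define \<omega> where "\<omega> t = t * (4 * (1/3 - t)\<^sup>2 + 1/16)" for t :: real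
  define W where "W t = 73/288 * t^2 - 8/9 * t^3 + t^4" for t :: real
  define W1 where "W1 t = 73/432 * t^3 - 2/3 * t^4 + 4/5 * t^5" for t :: real
  \<comment> \<open>Two integrations by parts of \<open>(t/6 - t^2/2) * h'' t\<close> lead to this
    antiderivative; its increment over \<open>[0, 1/2]\<close> is the quantity to be
    bounded.\<close>
  define \<Phi> where "\<Phi> t = (t / 6 - t\<^sup>2 / 2) * h' t - (1/6 - t) * h t - H t" for t
  define \<Psi> where "\<Psi> t = S / 2 * (c powr (1 / q) *
    ((1 - 1 / q) * W t + 1 / q * ((A * W t + (B - A) * W1 t) / c)))" for t
  have "c \<ge> 0" using c \<open>0 \<le> A\<close> \<open>0 \<le> B\<close> by linarith
  have tangent: "G t powr (1 / q) \<le> c powr (1 / q) * (1 - 1 / q + 1 / q * (G t / c))"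
    if "t \<in> {0..1/2}" for t
  \<comment> \<open>If \<open>c = 0\<close>, the hypothesis on \<open>c\<close> forces
    \<open>A = B = 0\<close>, and both sides vanish because
    \<open>0 powr (1 / q) = 0\<close>.\<close>
  proof (cases "c = 0")
    case True
    then have "A = 0" "B = 0" using c \<open>0 \<le> A\<close> \<open>0 \<le> B\<close> by linarith+
    then show ?thesis using \<open>c = 0\<close> by (simp add: G_def)
  next
    case False
    moreover have "0 \<le> G t" using that \<open>0 \<le> A\<close> \<open>0 \<le> B\<close> by (simp add: G_def)
    ultimately show ?thesis using q \<open>c \<ge> 0\<close> by (intro powr_tangent) auto
  qed
  have kernel: "\<bar>t / 6 - t\<^sup>2 / 2\<bar> \<le> \<omega> t / 2" if "t \<ge> 0" for t :: real
  proof -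
    \<comment> \<open>AM-GM, so that \<open>\<omega>\<close> is a polynomial; the coefficients are tuned to the slack available for \<open>c\<close>\<close>
    have "0 \<le> (2 * \<bar>1/3 - t\<bar> - 1/4)\<^sup>2" by simp
    then have "\<bar>1/3 - t\<bar> \<le> 4 * (1/3 - t)\<^sup>2 + 1/16"
      by (simp add: power2_diff power_mult_distrib power_divide)
    then have "t / 2 * \<bar>1/3 - t\<bar> \<le> t / 2 * (4 * (1/3 - t)\<^sup>2 + 1/16)"
      using that by (intro mult_left_mono) auto
    moreover have factor: "t / 6 - t\<^sup>2 / 2 = t / 2 * (1/3 - t)"
      by (simp add: power2_eq_square algebra_simps)
    ultimately show ?thesis unfolding factor using that by (simp add: \<omega>_def abs_mult)
  qed
  have d\<Phi>: "(\<Phi> has_real_derivative (t / 6 - t\<^sup>2 / 2) * h'' t) (at t within {0..1/2})"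
    if "t \<in> {0..1/2}" for t
    unfolding \<Phi>_def
    by (auto intro!: derivative_eq_intros H[OF that] h[OF that] h'[OF that])
  have dW: "(W has_real_derivative \<omega> t) (at t within X)" for t X
  proof -
    have "73/288 * (2 * t) - 8/9 * (3 * t^2) + 4 * t^3 = \<omega> t"
      by (simp add: \<omega>_def power2_eq_square power3_eq_cube algebra_simps)
    then show ?thesis unfolding W_def by (auto intro!: derivative_eq_intros)
  qed
  have dW1: "(W1 has_real_derivative t * \<omega> t) (at t within X)" for t X
  proof -
    have "73/432 * (3 * t^2) - 2/3 * (4 * t^3) + 4/5 * (5 * t^4) = t * \<omega> t"
      by (simp add: \<omega>_def power2_eq_square power3_eq_cube power4_eq_xxxx algebra_simps)
    then show ?thesis unfolding W1_def by (auto intro!: derivative_eq_intros)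
  qed
  have d\<Psi>: "(\<Psi> has_real_derivative
      \<omega> t / 2 * (S * (c powr (1 / q) * (1 - 1 / q + 1 / q * (G t / c))))) (at t within X)" for t X
  proof -
    have "(\<Psi> has_real_derivative S / 2 * (c powr (1 / q) *
        ((1 - 1 / q) * \<omega> t + 1 / q * ((A * \<omega> t + (B - A) * (t * \<omega> t)) / c)))) (at t within X)"
      unfolding \<Psi>_def by (intro DERIV_cmult DERIV_add DERIV_cdivide dW dW1)
    moreover have "A * \<omega> t + (B - A) * (t * \<omega> t) = \<omega> t * G t"
      by (simp add: G_def algebra_simps)
    ultimately have "(\<Psi> has_real_derivative S / 2 * (c powr (1 / q) *
        ((1 - 1 / q) * \<omega> t + 1 / q * (\<omega> t * G t / c)))) (at t within X)"
      by (simp only:)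
    then show ?thesis by (simp add: algebra_simps)
  qed
  \<comment> \<open>Mean value inequality: the derivative of \<open>\<Psi>\<close> is the kernel
    majorant \<open>\<omega> t / 2\<close> times the tangent bound for
    \<open>\<bar>h'' t\<bar>\<close>, hence dominates that of \<open>\<Phi>\<close>.\<close>
  have "norm (\<Phi> (1/2) - \<Phi> 0) \<le> \<Psi> (1/2) - \<Psi> 0"
  proof (rule differentiable_bound_general)
    show "continuous_on {0..1/2} \<Phi>" by (rule DERIV_continuous_on, rule d\<Phi>)
    show "continuous_on {0..1/2} \<Psi>" by (rule DERIV_continuous_on, rule d\<Psi>)
    fix t :: real assume t: "0 < t" "t < 1/2"
    then have "at t within {0..1/2} = at t" by (intro at_within_interior) auto
    then show "(\<Phi> has_vector_derivative (t / 6 - t\<^sup>2 / 2) * h'' t) (at t)"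
      using d\<Phi>[of t] t by (simp add: has_real_derivative_iff_has_vector_derivative)
    show "(\<Psi> has_vector_derivative
        \<omega> t / 2 * (S * (c powr (1 / q) * (1 - 1 / q + 1 / q * (G t / c))))) (at t)"
      using d\<Psi>[of t UNIV] by (simp add: has_real_derivative_iff_has_vector_derivative)
    have "\<bar>h'' t\<bar> \<le> S * G t powr (1 / q)" using h''[of t] t by (simp add: G_def)
    also have "S * G t powr (1 / q) \<le> S * (c powr (1 / q) * (1 - 1 / q + 1 / q * (G t / c)))"
      using t S by (intro mult_left_mono tangent) auto
    finally have "\<bar>h'' t\<bar> \<le> S * (c powr (1 / q) * (1 - 1 / q + 1 / q * (G t / c)))" .
    moreover have "0 \<le> \<omega> t" using t by (simp add: \<omega>_def)
    ultimately show "norm ((t / 6 - t\<^sup>2 / 2) * h'' t) \<le>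
        \<omega> t / 2 * (S * (c powr (1 / q) * (1 - 1 / q + 1 / q * (G t / c))))"
      unfolding real_norm_def abs_mult[of _ "h'' t"] using t kernel[of t]
      by (intro mult_mono) auto
  qed auto
  moreover have "\<Phi> (1/2) - \<Phi> 0 = h 0 / 6 + h (1/2) / 3 - h' (1/2) / 24 - (H (1/2) - H 0)"
    by (simp add: \<Phi>_def power_divide)
  moreover have "\<Psi> (1/2) - \<Psi> 0 \<le> S / 128 * c powr (1 / q)"
  proof -
    \<comment> \<open>For \<open>c = 0\<close> the quotient is \<open>0\<close> by convention, so
      the bound persists.\<close>
    have "(77 / 17280 * B + 89 / 8640 * A) / c \<le> 1 / 64"
      using c \<open>c \<ge> 0\<close> by (cases "c = 0") (auto simp: field_simps)
    then have "(1 - 1 / q) * (17/1152) + 1 / q * ((77 / 17280 * B + 89 / 8640 * A) / c) \<le>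
        (1 - 1 / q) * (1/64) + 1 / q * (1/64)"
      using q by (intro add_mono mult_left_mono) auto
    then have "S / 2 * (c powr (1 / q) * ((1 - 1 / q) * (17/1152) +
        1 / q * ((77 / 17280 * B + 89 / 8640 * A) / c))) \<le> S / 2 * (c powr (1 / q) * (1/64))"
      using S by (intro mult_left_mono) (auto simp: field_simps)
    moreover have "A * W (1/2) + (B - A) * W1 (1/2) = 77 / 17280 * B + 89 / 8640 * A"
      and "W (1/2) = 17/1152" and "\<Psi> 0 = 0"
      by (simp_all add: W_def W1_def \<Psi>_def power_divide algebra_simps diff_divide_distrib)
    then have "\<Psi> (1/2) - \<Psi> 0 = S / 2 * (c powr (1 / q) * ((1 - 1 / q) * (17/1152) +
        1 / q * ((77 / 17280 * B + 89 / 8640 * A) / c)))"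
      by (simp only: \<Psi>_def[of "1/2"] diff_zero)
    ultimately show ?thesis by simp
  qed
  ultimately show ?thesis by simp
qed

section \<open>Comparison of the constants, and the affine substitution\<close>

text \<open>In the derivative of the gap, Bernoulli at \<open>y\<close> and at \<open>- y\<close>
  applies since \<open>r - 1 \<ge> 1\<close>, and the two linear terms cancel.\<close>

lemma powr_central_difference:
  fixes r x :: real
  assumes "2 \<le> r" "0 \<le> x" "x < 1"
  shows "2 * r * x \<le> (1 + x) powr r - (1 - x) powr r"
proof -
  let ?\<phi> = "\<lambda>x. (1 + x) powr r - (1 - x) powr r - 2 * r * x"
  have "?\<phi> 0 \<le> ?\<phi> x"
  proof (rule DERIV_nonneg_imp_nondecreasing[where f = ?\<phi>])
    fix y assume y: "0 \<le> y" "y \<le> x"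
    have "(?\<phi> has_real_derivative r * ((1 + y) powr (r - 1) + (1 - y) powr (r - 1) - 2)) (at y)"
      using y assms by (auto intro!: derivative_eq_intros simp: algebra_simps)
    moreover have "0 \<le> r * ((1 + y) powr (r - 1) + (1 - y) powr (r - 1) - 2)"
      using y assms Bernoulli_powr[of y "r - 1"] Bernoulli_powr[of "- y" "r - 1"]
      by (intro mult_nonneg_nonneg) auto
    ultimately show "\<exists>d. (?\<phi> has_real_derivative d) (at y) \<and> 0 \<le> d" by blast
  qed (use assms in auto)
  then show ?thesis by simp
qed

text \<open>Taking \<open>p\<close>-th powers and clearing denominators leaves
  \<open>(p + 1) * 3 powr p \<le> 2 powr p * (2 powr (p + 1) - 1)\<close>. This is the central
  difference bound at \<open>x = 1/3\<close> with exponent \<open>p + 1\<close>, where the bases are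
  \<open>4/3\<close> and \<open>2/3\<close>.\<close>

lemma simpson_constant_ge:
  fixes p :: real
  assumes "1 \<le> p"
  shows "1 / 8 * (1 / 6) powr (1 / p)
    \<le> ((2 powr (p + 1) - 1) / (2 powr (2 * p + 1) * 3 powr (p + 1) * (p + 1))) powr (1 / p)"
proof -
  define P Q where "P = (2::real) powr p" and "Q = (3::real) powr p"
  have pos: "P > 0" "Q > 0" by (auto simp: P_def Q_def)
  have PP: "2 powr (2 * p) = P * P" using powr_add[of 2 p p] by (simp add: P_def)
  have "(4::real) powr p = P * P" using powr_mult[of 2 2 p] by (simp add: P_def)
  moreover have "(8::real) powr p = P * P * P" using powr_mult[of 2 4 p] calculation by (simp add: P_def)
  ultimately have P48: "(4::real) powr p = P * P" "(8::real) powr p = P * P * P" by auto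
  have "2 * (p + 1) * (1/3) \<le> (1 + 1/3) powr (p + 1) - (1 - 1/3) powr (p + 1)"
    using assms by (intro powr_central_difference) auto
  also have "\<dots> = 2/3 * (P / Q) * (2 * P - 1)"
    by (simp add: powr_add powr_divide P48 flip: P_def Q_def) (simp add: algebra_simps diff_divide_distrib)
  finally have "(p + 1) * Q \<le> P * (2 * P - 1)"
    using pos by (simp add: field_simps)
  then have "1 / (6 * (P * P * P)) \<le> (2 * P - 1) / (P * P * 2 * (Q * 3) * (p + 1))"
    using assms pos by (simp add: divide_simps) (simp add: ac_simps)
  then have "(1/8) powr p * (1/6) \<le> (2 powr (p + 1) - 1) / (2 powr (2 * p + 1) * 3 powr (p + 1) * (p + 1))"
    by (simp add: powr_add powr_divide PP P48 flip: P_def Q_def) (simp add: ac_simps)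
  then have "((1/8) powr p * (1/6)) powr (1 / p)
      \<le> ((2 powr (p + 1) - 1) / (2 powr (2 * p + 1) * 3 powr (p + 1) * (p + 1))) powr (1 / p)"
    using assms by (intro powr_mono2) auto
  also have "((1/8) powr p * (1/6)) powr (1 / p) = 1 / 8 * (1 / 6) powr (1 / p)"
    unfolding powr_mult powr_powr using assms by simp
  finally show ?thesis .
qed

text \<open>Working within sets keeps one-sided derivatives at endpoints, and a negative
  \<open>s\<close> covers the half traversed backwards from \<open>b\<close>.\<close>

lemma has_real_derivative_affine:
  fixes g g' :: "real \<Rightarrow> real"
  assumes "\<And>x. x \<in> T \<Longrightarrow> (g has_real_derivative g' x) (at x within T)"
    and "(\<lambda>t. x + s * t) ` X \<subseteq> T" "t \<in> X"
  shows "((\<lambda>t. g (x + s * t)) has_real_derivative s * g' (x + s * t)) (at t within X)"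
proof -
  have "(g has_real_derivative g' (x + s * t)) (at (x + s * t) within (\<lambda>t. x + s * t) ` X)"
    using assms by (blast intro: has_field_derivative_subset)
  moreover have "((\<lambda>t. x + s * t) has_real_derivative s) (at t within X)"
    by (auto intro!: derivative_eq_intros)
  ultimately have "(g \<circ> (\<lambda>t. x + s * t) has_real_derivative g' (x + s * t) * s) (at t within X)"
    by (rule DERIV_image_chain)
  then show ?thesis by (simp add: o_def mult.commute)
qed

text \<open>The right-hand side is \<open>2 * (4/3) powr (q - 1)\<close>; use
  \<open>ln (4/3) \<ge> 1/4\<close> and the quadratic Taylor bound for \<open>exp\<close>.\<close>

lemma simpson_scale_ge:
  fixes q :: real
  assumes "1 \<le> q"
  shows "2 + (q - 1) / 2 + (q - 1)\<^sup>2 / 16 \<le> 16 * (8/3) powr (q - 1) / 2 powr (q + 2)"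
proof -
  have "1 / 4 \<le> ln (4/3::real)"
    using ln_le_minus_one[of "3/4"] by (simp add: ln_div)
  then have "(q - 1) * (1/4) \<le> (q - 1) * ln (4/3)"
    using assms by (intro mult_left_mono) auto
  then have "exp ((q - 1) / 4) \<le> (4/3) powr (q - 1)" by (simp add: powr_def)
  moreover have "1 + (q - 1) / 4 + ((q - 1) / 4)\<^sup>2 / 2 \<le> exp ((q - 1) / 4)"
    using assms by (intro exp_lower_Taylor_quadratic) auto
  ultimately have "2 + (q - 1) / 2 + (q - 1)\<^sup>2 / 16 \<le> 2 * (4/3) powr (q - 1)"
    by (simp add: power_divide)
  also have "(4/3::real) powr (q - 1) = (8/3) powr (q - 1) / 2 powr (q - 1)"
    by (simp flip: powr_divide)
  also have "2 * ((8/3) powr (q - 1) / 2 powr (q - 1)) = 16 * (8/3) powr (q - 1) / 2 powr (q + 2)"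
    by (simp add: powr_add powr_diff)
  finally show ?thesis .
qed

text \<open>When \<open>a\<close> or \<open>b\<close> is an endpoint of \<open>I\<close>, interior
  differentiability says nothing there; the derivatives within \<open>I\<close> give
  \<open>f'' a\<close> and \<open>f'' b\<close> their meaning.\<close>

theorem proposition3:
  fixes I :: "real set" and f f' f'' :: "real \<Rightarrow> real" and a b p q :: real
  assumes "is_interval I"
    and "a \<in> I" and "b \<in> I" and "a < b"
    and "\<And>x. x \<in> interior I \<Longrightarrow> (f has_real_derivative f' x) (at x)"
    and "\<And>x. x \<in> interior I \<Longrightarrow> (f' has_real_derivative f'' x) (at x)"
    and "\<And>x. x \<in> {a, b} \<Longrightarrow> (f has_real_derivative f' x) (at x within I)"
    and "\<And>x. x \<in> {a, b} \<Longrightarrow> (f' has_real_derivative f'' x) (at x within I)"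
    and "f absolutely_integrable_on {a..b}"
    and "f' absolutely_integrable_on {a..b}"
    and "f'' absolutely_integrable_on {a..b}"
    and "p \<ge> 1" and "q \<ge> 1" and "1 / p + 1 / q = 1"
    and "convex_on {a..b} (\<lambda>x. \<bar>f'' x\<bar> powr q)"
  shows "\<bar>1 / 6 * (f a + 4 * f ((a + b) / 2) + f b) - 1 / (b - a) * integral {a..b} f\<bar>
    \<le> (b - a)\<^sup>2
      * ((2 powr (p + 1) - 1) / (2 powr (2 * p + 1) * 3 powr (p + 1) * (p + 1))) powr (1 / p)
      * ((1 / (2 powr (q + 2) * (q + 2)) * \<bar>f'' b\<bar> powr q
            + incomplete_Beta (1 / 2) (q + 1) 2 * \<bar>f'' a\<bar> powr q) powr (1 / q)
        + (incomplete_Beta (1 / 2) (q + 1) 2 * \<bar>f'' b\<bar> powr q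
            + 1 / (2 powr (q + 2) * (q + 2)) * \<bar>f'' a\<bar> powr q) powr (1 / q))"
proof -
  define L where "L = b - a"
  define F where "F x = integral {a..x} f" for x
  define A B where "A = \<bar>f'' a\<bar> powr q" and "B = \<bar>f'' b\<bar> powr q"
  define u v where "u = 1 / (2 powr (q + 2) * (q + 2))" and "v = incomplete_Beta (1 / 2) (q + 1) 2"
  \<comment> \<open>\<open>\<tau>\<close> is chosen such that \<open>\<tau> powr (1/q) / 128\<close> is the lower bound of \<open>K\<close> from \<open>simpson_constant_ge\<close>\<close>
  define \<tau> where "\<tau> = 16 * (8/3) powr (q - 1)"
  define K where "K = ((2 powr (p + 1) - 1) / (2 powr (2 * p + 1) * 3 powr (p + 1) * (p + 1))) powr (1 / p)"
  have L: "L > 0" using \<open>a < b\<close> by (simp add: L_def)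
  have "{a..b} \<subseteq> I"
    using mem_is_interval_1_I[OF assms(1-3)] by auto
  then have "{a<..<b} \<subseteq> interior I"
    by (intro interior_maximal order_trans[OF _ \<open>{a..b} \<subseteq> I\<close>]) auto
  have within: "(g has_real_derivative g' x) (at x within {a..b})"
    if "\<And>x. x \<in> interior I \<Longrightarrow> (g has_real_derivative g' x) (at x)"
      and "\<And>x. x \<in> {a, b} \<Longrightarrow> (g has_real_derivative g' x) (at x within I)"
      and "x \<in> {a..b}" for g g' x
  proof (cases "x \<in> {a, b}")
    case True
    then show ?thesis using that(2) \<open>{a..b} \<subseteq> I\<close> has_field_derivative_subset by blast
  next
    case False
    then have "x \<in> interior I" using that(3) \<open>{a<..<b} \<subseteq> interior I\<close> by auto
    then show ?thesis using that(1) has_field_derivative_at_within by blast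
  qed
  have df: "(f has_real_derivative f' x) (at x within {a..b})" if "x \<in> {a..b}" for x
    using assms(5,7) that by (rule within)
  have df': "(f' has_real_derivative f'' x) (at x within {a..b})" if "x \<in> {a..b}" for x
    using assms(6,8) that by (rule within)
  have dF: "(F has_real_derivative f x) (at x within {a..b})" if "x \<in> {a..b}" for x
    unfolding F_def using DERIV_continuous_on[OF df] that by (rule integral_has_real_derivative)
  have AB: "A \<ge> 0" "B \<ge> 0" by (auto simp: A_def B_def)
  have bound: "\<bar>f'' (a + L * t)\<bar> \<le> (t * B + (1 - t) * A) powr (1 / q)" if "t \<in> {0..1}" for t
  proof -
    have "\<bar>f'' ((1 - t) *\<^sub>R a + t *\<^sub>R b)\<bar> powr q \<le> (1 - t) * A + t * B"
      unfolding A_def B_def using assms(4,15) that by (intro convex_onD) auto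
    then have "\<bar>f'' (a + L * t)\<bar> powr q \<le> t * B + (1 - t) * A"
      by (simp add: L_def algebra_simps)
    then have "(\<bar>f'' (a + L * t)\<bar> powr q) powr (1 / q) \<le> (t * B + (1 - t) * A) powr (1 / q)"
      using \<open>q \<ge> 1\<close> by (intro powr_mono2) auto
    then show ?thesis using \<open>q \<ge> 1\<close> by (simp add: powr_powr)
  qed

  \<comment> \<open>Lower bounds for \<open>\<tau> * u\<close> and \<open>\<tau> * v\<close>\<close>
  have u: "u > 0" using \<open>q \<ge> 1\<close> by (simp add: u_def)
  have v_eq: "v = u * ((q + 3) / (q + 1))"
    unfolding u_def v_def using \<open>q \<ge> 1\<close> by (subst incomplete_Beta_half) (simp_all add: ac_simps)
  then have v: "v > 0" using u \<open>q \<ge> 1\<close> by simp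
  define x where "x = q - 1"
  have x: "x \<ge> 0" "q = x + 1" using \<open>q \<ge> 1\<close> by (auto simp: x_def)
  have \<tau>: "2 + x / 2 + x\<^sup>2 / 16 \<le> \<tau> * u * (q + 2)"
    using simpson_scale_ge[OF \<open>q \<ge> 1\<close>] \<open>q \<ge> 1\<close> by (simp add: \<tau>_def u_def x_def)
  have "0 \<le> x\<^sup>2 / 16 + x / 6 + 1" using x by simp
  then have "1 / 3 * (q + 2) \<le> 2 + x / 2 + x\<^sup>2 / 16" by (simp add: x(2))
  also note \<tau>
  finally have \<tau>u: "1 / 3 \<le> \<tau> * u"
    by (rule mult_right_le_imp_le) (use \<open>q \<ge> 1\<close> in simp)
  \<comment> \<open>The linear function \<open>x + 3/2\<close> majorizes
    \<open>(q + 1) * (q + 2) / (q + 3)\<close>, with equality at \<open>x = 0\<close>. The gap in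
    the next inequality is \<open>(x - 4/3)^2 / 16 + 8/9\<close>.\<close>
  have "0 \<le> (x - 4/3)\<^sup>2" by simp
  then have "2 / 3 * (x + 3/2) \<le> 2 + x / 2 + x\<^sup>2 / 16"
    by (simp add: power2_diff power_divide)
  also note \<tau>
  finally have "2 / 3 * (x + 3/2) \<le> \<tau> * u * (q + 2)" .
  then have "2 / 3 * (x + 3/2) * (q + 3) \<le> \<tau> * u * (q + 2) * (q + 3)"
    using x by (intro mult_right_mono) auto
  moreover have "2 / 3 * ((q + 1) * (q + 2)) \<le> 2 / 3 * (x + 3/2) * (q + 3)"
    using x by (simp add: algebra_simps add_divide_distrib)
  moreover have "\<tau> * u * (q + 2) * (q + 3) = \<tau> * v * ((q + 1) * (q + 2))"
    using \<open>q \<ge> 1\<close> by (simp add: v_eq)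
  ultimately have "2 / 3 * ((q + 1) * (q + 2)) \<le> \<tau> * v * ((q + 1) * (q + 2))"
    by linarith
  then have \<tau>v: "2 / 3 \<le> \<tau> * v"
    by (rule mult_right_le_imp_le) (use \<open>q \<ge> 1\<close> in simp)
  \<comment> \<open>Divided by 64, the bounds \<open>1/3\<close> and \<open>2/3\<close> become
    \<open>90/17280\<close> and \<open>90/8640\<close>.\<close>
  have weight: "77 / 17280 * Y + 89 / 8640 * X \<le> \<tau> * (u * Y + v * X) / 64"
    if "X \<ge> 0" "Y \<ge> 0" for X Y
    using mult_right_mono[OF \<tau>u \<open>Y \<ge> 0\<close>] mult_right_mono[OF \<tau>v \<open>X \<ge> 0\<close>] that
    by (simp add: algebra_simps)
  have p_q: "1 / q = 1 - 1 / p" using \<open>1 / p + 1 / q = 1\<close> by simp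
  moreover have "(q - 1) * (1 - 1 / p) = 1 / p"
  proof -
    have "(q - 1) * (1 / q) = 1 - 1 / q" using \<open>q \<ge> 1\<close> by (simp add: diff_divide_distrib)
    then show ?thesis by (simp only: p_q)
  qed
  ultimately have "\<tau> powr (1 / q) = 16 powr (1 - 1 / p) * (8/3) powr (1 / p)"
    by (simp add: \<tau>_def powr_mult powr_powr)
  \<comment> \<open>Here \<open>(8/3) / 16 = 1/6\<close>, the base in
    \<open>simpson_constant_ge\<close>.\<close>
  also have "\<dots> = 16 * ((8/3) / 16) powr (1 / p)"
    unfolding powr_diff powr_divide by simp
  also have "\<dots> \<le> 128 * K"
    using simpson_constant_ge[OF \<open>p \<ge> 1\<close>] by (simp add: K_def)
  finally have "\<tau> powr (1 / q) / 128 \<le> K" by simp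
  then have scale: "L\<^sup>2 / 128 * (\<tau> * Z) powr (1 / q) \<le> L\<^sup>2 * K * Z powr (1 / q)" if "Z \<ge> 0" for Z
    using mult_left_mono[of "\<tau> powr (1 / q) / 128" K "L\<^sup>2 * Z powr (1 / q)"] that
    by (simp add: powr_mult \<tau>_def ac_simps)

  \<comment> \<open>Rescaling the two halves and adding them\<close>
  have Lt: "0 \<le> L * t" "L * t \<le> L" if "t \<in> {0..1/2}" for t
    using L that by (auto simp: mult_left_le)
  have left: "(\<lambda>t. a + L * t) ` {0..1/2} \<subseteq> {a..b}"
    using Lt by (force simp: L_def)
  have right: "(\<lambda>t. b + - L * t) ` {0..1/2} \<subseteq> {a..b}"
  proof (rule image_subsetI)
    fix t :: real assume "t \<in> {0..1/2}"
    moreover have "b = a + L" by (simp add: L_def)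
    ultimately show "b + - L * t \<in> {a..b}" using Lt[of t] by simp
  qed
  have left_half: "\<bar>f (a + L * 0) / 6 + f (a + L * (1/2)) / 3 - L * f' (a + L * (1/2)) / 24
      - (F (a + L * (1/2)) / L - F (a + L * 0) / L)\<bar> \<le> L\<^sup>2 / 128 * (\<tau> * (u * B + v * A)) powr (1 / q)"
  proof (rule simpson_half[where h'' = "\<lambda>t. L\<^sup>2 * f'' (a + L * t)" and h' = "\<lambda>t. L * f' (a + L * t)"
        and h = "\<lambda>t. f (a + L * t)" and H = "\<lambda>t. F (a + L * t) / L" and A = A and B = B])
    fix t :: real assume t: "t \<in> {0..1/2}"
    note chain = has_real_derivative_affine[OF _ left t]
    show "((\<lambda>t. F (a + L * t) / L) has_real_derivative f (a + L * t)) (at t within {0..1/2})"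
      using DERIV_cdivide[OF chain[OF dF], of L] L by simp
    show "((\<lambda>t. f (a + L * t)) has_real_derivative L * f' (a + L * t)) (at t within {0..1/2})"
      by (rule chain[OF df])
    show "((\<lambda>t. L * f' (a + L * t)) has_real_derivative L\<^sup>2 * f'' (a + L * t)) (at t within {0..1/2})"
      using DERIV_cmult[OF chain[OF df'], of L] by (simp add: power2_eq_square mult.assoc)
    show "\<bar>L\<^sup>2 * f'' (a + L * t)\<bar> \<le> L\<^sup>2 * (t * B + (1 - t) * A) powr (1 / q)"
      using bound[of t] t by (simp add: abs_mult mult_left_mono)
  qed (use AB \<open>q \<ge> 1\<close> weight in auto)
  \<comment> \<open>Reflection: the slope is \<open>- L\<close>, the roles of \<open>A\<close> and
    \<open>B\<close> are exchanged, and \<open>h'\<close> acquires a minus sign.\<close>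
  have right_half: "\<bar>f (b + - L * 0) / 6 + f (b + - L * (1/2)) / 3 - (- L * f' (b + - L * (1/2))) / 24
      - (F (b + - L * (1/2)) / - L - F (b + - L * 0) / - L)\<bar>
      \<le> L\<^sup>2 / 128 * (\<tau> * (u * A + v * B)) powr (1 / q)"
  proof (rule simpson_half[where h'' = "\<lambda>t. L\<^sup>2 * f'' (b + - L * t)" and h' = "\<lambda>t. - L * f' (b + - L * t)"
        and h = "\<lambda>t. f (b + - L * t)" and H = "\<lambda>t. F (b + - L * t) / - L" and A = B and B = A])
    fix t :: real assume t: "t \<in> {0..1/2}"
    note chain = has_real_derivative_affine[OF _ right t]
    show "((\<lambda>t. F (b + - L * t) / - L) has_real_derivative f (b + - L * t)) (at t within {0..1/2})"
      using DERIV_cdivide[OF chain[OF dF], of "- L"] L by simp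
    show "((\<lambda>t. f (b + - L * t)) has_real_derivative - L * f' (b + - L * t)) (at t within {0..1/2})"
      by (rule chain[OF df])
    show "((\<lambda>t. - L * f' (b + - L * t)) has_real_derivative L\<^sup>2 * f'' (b + - L * t)) (at t within {0..1/2})"
      using DERIV_cmult[OF chain[OF df'], of "- L"] by (simp add: power2_eq_square mult.assoc)
    have "b + - L * t = a + L * (1 - t)" by (simp add: L_def algebra_simps)
    then show "\<bar>L\<^sup>2 * f'' (b + - L * t)\<bar> \<le> L\<^sup>2 * (t * A + (1 - t) * B) powr (1 / q)"
      using bound[of "1 - t"] t by (simp add: abs_mult mult_left_mono add.commute)
  qed (use AB \<open>q \<ge> 1\<close> weight in auto)
  define m where "m = (a + b) / 2"
  have nodes: "a + L * 0 = a" "a + L * (1/2) = m" "b + - L * 0 = b" "b + - L * (1/2) = m"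
    by (simp_all add: L_def m_def diff_divide_distrib add_divide_distrib)
  have "F a = 0" by (simp add: F_def)
  \<comment> \<open>The midpoint terms in \<open>f' m\<close> and \<open>F m\<close> occur with
    opposite signs in the two halves and cancel.\<close>
  then have "1 / 6 * (f a + 4 * f m + f b) - 1 / L * F b =
      (f a / 6 + f m / 3 - L * f' m / 24 - (F m / L - F a / L)) +
      (f b / 6 + f m / 3 - (- L * f' m) / 24 - (F m / - L - F b / - L))"
    by simp
  with left_half[unfolded nodes] right_half[unfolded nodes] have "\<bar>1 / 6 * (f a + 4 * f m + f b) - 1 / L * F b\<bar>
      \<le> L\<^sup>2 / 128 * (\<tau> * (u * B + v * A)) powr (1 / q) + L\<^sup>2 / 128 * (\<tau> * (u * A + v * B)) powr (1 / q)"
    by linarith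
  also have "\<dots> \<le> L\<^sup>2 * K * (u * B + v * A) powr (1 / q) + L\<^sup>2 * K * (u * A + v * B) powr (1 / q)"
    using u v AB by (intro add_mono scale) auto
  also have "\<dots> = L\<^sup>2 * K * ((u * B + v * A) powr (1 / q) + (v * B + u * A) powr (1 / q))"
    by (simp only: distrib_left add.commute[of "u * A"])
  finally show ?thesis
    unfolding A_def B_def u_def v_def K_def L_def F_def m_def .
qed

end
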